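(* Let $t\ge s\ge 2$ be integers. Then: (i) $r(K_{n,n},K_{s,t},st-s+2)=\Theta(n^2)$. (ii) If $2\le s\le 3$, then $r\!\left(K_{n,n},K_{s,t},st-\lfloor t/2\rfloor+1\right)=\Theta(n^2)$. (iii) If $s\ge 4$ and at least one of $s,t$ is even, then $r\!\left(K_{n,n},K_{s,t},st-\lfloor (s+t)/2\rfloor+3\right)=\Theta(n^2)$. (iv) If $s\ge 5$ and both $s$ and $t$ are odd, then $r\!\left(K_{n,n},K_{s,t},st-\lfloor (s+t)/2\rfloor+4\right)=\Theta(n^2)$.
   Context: For graphs $G,H$ and an integer $q$ with $2\le q\le |E(H)|$, an $(H,q)$-coloring of $G$ is an edge-coloring of $G$ in which every subgraph of $G$ isomorphic to $H$ receives at least $q$ distinct colors; $r(G,H,q)$ is the minimum number of colors needed for $G$ to have an $(H,q)$-coloring. $K_{n,n}$, $K_{s,t}$ denote complete bipartite graphs. Asymptotic notation refers to $n\to\infty$ with $s,t$ fixed. *)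

theory Defs
  imports Complex_Main "HOL-Library.Landau_Symbols"
begin

record 'a graph =
  verts :: "'a set"
  edges :: "'a set set"

definition simple_graph :: "'a graph \<Rightarrow> bool" where
  "simple_graph G \<longleftrightarrow> (\<forall>e \<in> edges G. e \<subseteq> verts G \<and> card e = 2)"

text \<open>Subgraphs need not be induced.\<close>

definition subgraph :: "'a graph \<Rightarrow> 'a graph \<Rightarrow> bool" where
  "subgraph F G \<longleftrightarrow> simple_graph F \<and> verts F \<subseteq> verts G \<and> edges F \<subseteq> edges G"

definition isomorphic :: "'a graph \<Rightarrow> 'b graph \<Rightarrow> bool" where
  "isomorphic F H \<longleftrightarrow> (\<exists>f. bij_betw f (verts F) (verts H) \<and>
     (\<forall>u \<in> verts F. \<forall>v \<in> verts F. {u, v} \<in> edges F \<longleftrightarrow> {f u, f v} \<in> edges H))"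

text \<open>Colorings need not be proper; the values of \<open>c\<close> outside \<open>edges G\<close> are irrelevant.\<close>

definition Hq_coloring :: "'a graph \<Rightarrow> 'b graph \<Rightarrow> nat \<Rightarrow> ('a set \<Rightarrow> nat) \<Rightarrow> bool" where
  "Hq_coloring G H q c \<longleftrightarrow>
     (\<forall>F. subgraph F G \<and> isomorphic F H \<longrightarrow> q \<le> card (c ` edges F))"

text \<open>
  The number \<open>r(G, H, q)\<close>. It is meant for finite simple graphs and
  \<open>2 \<le> q \<le> card (edges H)\<close>; then an injective coloring shows that the minimum exists.
\<close>

definition gen_ramsey :: "'a graph \<Rightarrow> 'b graph \<Rightarrow> nat \<Rightarrow> nat" where
  "gen_ramsey G H q = (LEAST k. \<exists>c. c ` edges G \<subseteq> {..<k} \<and> Hq_coloring G H q c)"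

definition complete_bipartite :: "nat \<Rightarrow> nat \<Rightarrow> (nat + nat) graph" where
  "complete_bipartite m n =
     \<lparr>verts = Inl ` {..<m} \<union> Inr ` {..<n}, edges = {{Inl i, Inr j} | i j. i < m \<and> j < n}\<rparr>"

lemma simple_graph_complete_bipartite: "simple_graph (complete_bipartite m n)"
  by (auto simp: simple_graph_def complete_bipartite_def)

lemma card_edges_complete_bipartite: "card (edges (complete_bipartite m n)) = m * n"
proof -
  have "edges (complete_bipartite m n) = (\<lambda>(i, j). {Inl i, Inr j}) ` ({..<m} \<times> {..<n})"
    by (auto simp: complete_bipartite_def)
  moreover have "inj_on (\<lambda>(i, j). {Inl i, Inr j} :: (nat + nat) set) ({..<m} \<times> {..<n})"
    by (auto simp: inj_on_def doubleton_eq_iff)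
  ultimately show ?thesis
    by (simp add: card_image card_cartesian_product)
qed

end

theory Submission
  imports Defs
begin

text \<open>
  Suppose that few colors are used. For part (i), some color occurs on \<open>s\<close> edges, and these meet
  at most \<open>s \<le> t\<close> vertices on each side, so they extend to a \<open>K\<^bsub>s,t\<^esub>\<close> in which \<open>s - 1\<close> colors
  are lost. For the other parts, a monochromatic star with \<open>t\<close> edges loses \<open>t - 1\<close> colors; without
  such stars, double counting yields two vertices \<open>a\<^sub>1, a\<^sub>2\<close> on the left such that many edges
  at \<open>a\<^sub>2\<close> have a color that occurs at \<open>a\<^sub>1\<close>. Each such edge loses a color at the cost of at most
  two vertices on the right, which gives \<open>t div 2\<close> lost colors. Doing the same with
  \<open>b\<^sub>1, b\<^sub>2\<close> on the right and joining the two configurations gives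
  \<open>(s - 2) div 2 + (t - 2) div 2\<close> lost colors.
\<close>

section \<open>Rectangles of a colored matrix that lose colors\<close>

text \<open>The coloring is treated as a matrix \<open>d\<close> with rows \<open>U\<close> and
  columns \<open>V\<close>; some \<open>s\<close> by \<open>t\<close> submatrix falls short of a
  rainbow one by at least \<open>x\<close> colors. The additive form avoids truncated
  subtraction.\<close>

definition has_repeats :: "nat \<Rightarrow> nat \<Rightarrow> nat \<Rightarrow> 'a set \<Rightarrow> 'b set \<Rightarrow> ('a \<Rightarrow> 'b \<Rightarrow> 'c) \<Rightarrow> bool" where
  "has_repeats s t x U V d \<longleftrightarrow> (\<exists>A\<subseteq>U. \<exists>B\<subseteq>V. card A = s \<and> card B = t \<and>
     card (case_prod d ` (A \<times> B)) + x \<le> s * t)"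

lemma has_repeats_mono: "has_repeats s t x U V d \<Longrightarrow> y \<le> x \<Longrightarrow> has_repeats s t y U V d"
  unfolding has_repeats_def
  by (elim exE conjE, intro exI conjI) (assumption | linarith)+

text \<open>Every value taken on \<open>R\<close> is also taken outside \<open>R\<close>, so
  \<open>R\<close> can be deleted from the domain without changing the image.\<close>

lemma card_image_redundant:
  assumes "finite S" "R \<subseteq> S" "f ` R \<subseteq> f ` (S - R)"
  shows "card (f ` S) + card R \<le> card S"
proof -
  have "f ` S = f ` (S - R)" using assms by blast
  then have "card (f ` S) \<le> card (S - R)" using assms(1) by (simp add: card_image_le)
  moreover have "card (S - R) + card R = card S"
    using assms by (metis card_Diff_subset card_mono finite_subset le_add_diff_inverse2)
  ultimately show ?thesis by linarith
qed

lemma extend_subset_card: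
  assumes "finite U" "A \<subseteq> U" "card A \<le> s" "s \<le> card U"
  obtains A' where "A \<subseteq> A'" "A' \<subseteq> U" "card A' = s"
proof -
  have fA: "finite A" using assms finite_subset by blast
  have "s - card A \<le> card (U - A)"
    using assms fA by (simp add: card_Diff_subset)
  then obtain C where C: "C \<subseteq> U - A" "card C = s - card A" "finite C"
    by (meson obtain_subset_with_card_n)
  have "card (A \<union> C) = s"
    using C fA assms(3) by (subst card_Un_disjoint) auto
  then show thesis using that[of "A \<union> C"] C assms(2) by blast
qed

text \<open>The pair \<open>S\<close>, \<open>R\<close> is a certificate: the color of each cell in
  \<open>R\<close> recurs in \<open>S - R\<close>. Only the number of rows and columns that
  \<open>S\<close> meets matters, since these can be enlarged to \<open>s\<close> rows and
  \<open>t\<close> columns, and \<open>R\<close> stays redundant in the larger rectangle.\<close>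

lemma has_repeatsI:
  assumes fin: "finite U" "finite V" and S: "S \<subseteq> U \<times> V"
    and "card (fst ` S) \<le> s" "s \<le> card U" "card (snd ` S) \<le> t" "t \<le> card V"
    and R: "R \<subseteq> S" "case_prod d ` R \<subseteq> case_prod d ` (S - R)"
  shows "has_repeats s t (card R) U V d"
proof -
  have "fst ` S \<subseteq> U" "snd ` S \<subseteq> V" using S by auto
  from extend_subset_card[OF fin(1) this(1) assms(4,5)] extend_subset_card[OF fin(2) this(2) assms(6,7)]
  obtain A B where A: "fst ` S \<subseteq> A" "A \<subseteq> U" "card A = s"
    and B: "snd ` S \<subseteq> B" "B \<subseteq> V" "card B = t"
    by (metis (no_types))
  have SAB: "S \<subseteq> A \<times> B" using A(1) B(1) by (force simp: subset_iff)
  have "finite (A \<times> B)" using A B fin by (meson finite_SigmaI finite_subset)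
  moreover have "R \<subseteq> A \<times> B" using SAB R by blast
  moreover have "case_prod d ` R \<subseteq> case_prod d ` (A \<times> B - R)"
    using R(2) SAB by blast
  ultimately have "card (case_prod d ` (A \<times> B)) + card R \<le> card (A \<times> B)"
    by (rule card_image_redundant)
  then show ?thesis
    unfolding has_repeats_def using A B by (auto simp: card_cartesian_product)
qed

text \<open>One cell of \<open>S\<close> keeps the color and all the others are redundant.\<close>

lemma monochromatic_has_repeats:
  assumes fin: "finite U" "finite V" and S: "S \<subseteq> U \<times> V" "S \<noteq> {}"
    and mono: "\<And>i j. (i, j) \<in> S \<Longrightarrow> d i j = \<gamma>"
    and "card (fst ` S) \<le> s" "s \<le> card U" "card (snd ` S) \<le> t" "t \<le> card V"
  shows "has_repeats s t (card S - 1) U V d"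
proof -
  obtain e where e: "e \<in> S" using S by blast
  have fS: "finite S" using S fin by (meson finite_SigmaI finite_subset)
  have "case_prod d p = case_prod d e" if "p \<in> S" for p
    using that e mono by (cases p; cases e) auto
  then have "case_prod d ` (S - {e}) \<subseteq> case_prod d ` (S - (S - {e}))"
    using e by blast
  then have "has_repeats s t (card (S - {e})) U V d"
    using assms by (intro has_repeatsI[where S = S]) auto
  then show ?thesis using e fS by simp
qed

lemma star_has_repeats:
  assumes fin: "finite U" "finite V" and i: "i \<in> U"
    and big: "t \<le> card {j \<in> V. d i j = \<gamma>}"
    and st: "1 \<le> s" "1 \<le> t" "s \<le> card U" "t \<le> card V"
  shows "has_repeats s t (t - 1) U V d"
proof -
  obtain B where B: "B \<subseteq> {j \<in> V. d i j = \<gamma>}" "card B = t" "finite B"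
    using big by (meson obtain_subset_with_card_n)
  have "B \<noteq> {}" using B st by auto
  then have "fst ` ({i} \<times> B) = {i}" "snd ` ({i} \<times> B) = B" by force+
  then have "has_repeats s t (card ({i} \<times> B) - 1) U V d"
    using B i st fin \<open>B \<noteq> {}\<close>
    by (intro monochromatic_has_repeats[where \<gamma> = \<gamma>]) auto
  then show ?thesis using B by (simp add: card_cartesian_product)
qed

text \<open>Transposition carries facts about rows over to columns, at the price of exchanging
  \<open>s\<close> and \<open>t\<close>.\<close>

lemma has_repeats_swap:
  assumes "has_repeats s t x V U (\<lambda>j i. d i j)"
  shows "has_repeats t s x U V d"
proof -
  obtain B A where AB: "B \<subseteq> V" "A \<subseteq> U" "card B = s" "card A = t"
    and c: "card (case_prod (\<lambda>j i. d i j) ` (B \<times> A)) + x \<le> s * t"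
    using assms unfolding has_repeats_def by blast
  have "case_prod (\<lambda>j i. d i j) ` (B \<times> A) = case_prod d ` (A \<times> B)" by force
  then show ?thesis unfolding has_repeats_def using AB c by (auto simp: mult.commute)
qed

section \<open>Pairs of rows or columns with many repeated colors\<close>

text \<open>The cells are counted in row \<open>a2\<close>, and \<open>a1\<close> only supplies the
  earlier occurrence of the color; the notion is not symmetric, and \<open>b' = b\<close> is
  allowed.\<close>

definition repeated :: "'b set \<Rightarrow> ('a \<Rightarrow> 'b \<Rightarrow> 'c) \<Rightarrow> 'a \<Rightarrow> 'a \<Rightarrow> 'b set" where
  "repeated V d a1 a2 = {b \<in> V. \<exists>b'\<in>V. d a1 b' = d a2 b}"

text \<open>Count the pairs of a row and a cell whose color occurs in that row. If no two distinct
  rows had more than \<open>M\<close> repeats, there would be at most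
  \<open>(M + 1) * (n * n)\<close> such pairs. A color class with \<open>e\<close> cells meets at
  least \<open>e / T\<close> rows, so this bounds the sum of the squared class sizes, whereas few
  colors force that sum to be large.\<close>

lemma exists_repeated_rows:
  fixes d :: "'a \<Rightarrow> 'b \<Rightarrow> 'c"
  assumes fin: "finite U" "finite V" and card: "card U = n" "card V = n"
    and col: "finite C" "\<And>i j. i \<in> U \<Longrightarrow> j \<in> V \<Longrightarrow> d i j \<in> C"
    and star: "\<And>i \<gamma>. i \<in> U \<Longrightarrow> card {j \<in> V. d i j = \<gamma>} \<le> T"
    and few: "T * (M + 1) * card C < n * n"
  shows "\<exists>a1\<in>U. \<exists>a2\<in>U. a1 \<noteq> a2 \<and> M < card (repeated V d a1 a2)"
proof (rule ccontr)
  assume "\<not> ?thesis"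
  then have small: "card (repeated V d a1 a2) \<le> M" if "a1 \<in> U" "a2 \<in> U" "a1 \<noteq> a2" for a1 a2
    using that by (meson leI)
  \<comment> \<open>\<open>E \<gamma>\<close> is the set of cells of color \<open>\<gamma>\<close>,
    and \<open>P \<gamma>\<close> the set of rows in which that color occurs.\<close>
  define E where "E \<gamma> = (SIGMA i:U. {j \<in> V. d i j = \<gamma>})" for \<gamma>
  define P where "P \<gamma> = {i \<in> U. \<exists>j\<in>V. d i j = \<gamma>}" for \<gamma>
  define D where "D = T * (M + 1)"
  have finE: "finite (E \<gamma>)" for \<gamma> unfolding E_def using fin by auto
  have finP: "finite (P \<gamma>)" for \<gamma> unfolding P_def using fin by auto
  have EP: "card (E \<gamma>) \<le> T * card (P \<gamma>)" for \<gamma>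
  proof -
    have "E \<gamma> = (SIGMA i:P \<gamma>. {j \<in> V. d i j = \<gamma>})" unfolding E_def P_def by auto
    then have "card (E \<gamma>) = (\<Sum>i\<in>P \<gamma>. card {j \<in> V. d i j = \<gamma>})"
      using finP fin by (simp add: card_SigmaI)
    also have "\<dots> \<le> (\<Sum>i\<in>P \<gamma>. T)" by (intro sum_mono star) (auto simp: P_def)
    finally show ?thesis by (simp add: mult.commute)
  qed
  have "U \<times> V = (\<Union>\<gamma>\<in>C. E \<gamma>)" unfolding E_def using col(2) by auto
  then have "card (U \<times> V) = (\<Sum>\<gamma>\<in>C. card (E \<gamma>))"
    using finE col(1) by (simp only:, intro card_UN_disjoint) (auto simp: E_def)
  then have total: "(\<Sum>\<gamma>\<in>C. card (E \<gamma>)) = n * n"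
    using card by (simp add: card_cartesian_product)
  have "(\<Sum>\<gamma>\<in>C. card (P \<gamma>) * card (E \<gamma>)) = (\<Sum>\<gamma>\<in>C. card (P \<gamma> \<times> E \<gamma>))"
    by (simp add: card_cartesian_product)
  also have "\<dots> = card (\<Union>\<gamma>\<in>C. P \<gamma> \<times> E \<gamma>)"
    using finE finP col(1) by (intro card_UN_disjoint[symmetric]) (auto simp: E_def)
  \<comment> \<open>The same pairs, now sorted by the given row \<open>i\<close> and the row
    \<open>i'\<close> of the cell instead of by color.\<close>
  also have "(\<Union>\<gamma>\<in>C. P \<gamma> \<times> E \<gamma>) = (SIGMA i:U. SIGMA i':U. repeated V d i i')"
    unfolding P_def E_def repeated_def using col(2) by auto
  also have "card \<dots> = (\<Sum>i\<in>U. \<Sum>i'\<in>U. card (repeated V d i i'))"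
    using fin by (simp add: card_SigmaI repeated_def)
  \<comment> \<open>The \<open>n\<close> diagonal terms are bounded trivially by \<open>n\<close>
    each; together they account for the \<open>+ 1\<close> in \<open>M + 1\<close>.\<close>
  also have "\<dots> \<le> (\<Sum>i\<in>U. \<Sum>i'\<in>U. M + (if i = i' then n else 0))"
  proof (intro sum_mono)
    fix i i' assume i: "i \<in> U" "i' \<in> U"
    have "card (repeated V d i i') \<le> n"
      using card_mono[OF fin(2), of "repeated V d i i'"] card by (auto simp: repeated_def)
    then show "card (repeated V d i i') \<le> M + (if i = i' then n else 0)"
      using small[OF i] by auto
  qed
  also have "\<dots> = (M + 1) * (n * n)"
    using fin card by (simp add: sum.distrib algebra_simps)
  finally have PE: "(\<Sum>\<gamma>\<in>C. card (P \<gamma>) * card (E \<gamma>)) \<le> (M + 1) * (n * n)" .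
  have "(\<Sum>\<gamma>\<in>C. card (E \<gamma>) * card (E \<gamma>)) \<le> (\<Sum>\<gamma>\<in>C. T * (card (P \<gamma>) * card (E \<gamma>)))"
    using EP by (intro sum_mono) (metis mult.assoc mult_le_mono1)
  also have "\<dots> \<le> D * (n * n)"
    using PE unfolding sum_distrib_left[symmetric] D_def by (metis mult.assoc mult_le_mono2)
  finally have sq: "(\<Sum>\<gamma>\<in>C. card (E \<gamma>) * card (E \<gamma>)) \<le> D * (n * n)" .
  \<comment> \<open>Summed over the colors, this linear bound takes the place of the Cauchy-Schwarz inequality.\<close>
  have "2 * D * card (E \<gamma>) \<le> card (E \<gamma>) * card (E \<gamma>) + D * D" for \<gamma>
  proof -
    have "0 \<le> (int (card (E \<gamma>)) - int D)\<^sup>2" by simp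
    then have "int (2 * D * card (E \<gamma>)) \<le> int (card (E \<gamma>) * card (E \<gamma>) + D * D)"
      by (simp add: power2_eq_square algebra_simps)
    then show ?thesis by linarith
  qed
  then have "(\<Sum>\<gamma>\<in>C. 2 * D * card (E \<gamma>)) \<le> (\<Sum>\<gamma>\<in>C. card (E \<gamma>) * card (E \<gamma>) + D * D)"
    by (intro sum_mono)
  moreover have "(\<Sum>\<gamma>\<in>C. 2 * D * card (E \<gamma>)) = 2 * D * (n * n)"
    by (simp only: sum_distrib_left[symmetric] total)
  moreover have "(\<Sum>\<gamma>\<in>C. card (E \<gamma>) * card (E \<gamma>) + D * D)
      = (\<Sum>\<gamma>\<in>C. card (E \<gamma>) * card (E \<gamma>)) + D * (D * card C)"
    by (simp add: sum.distrib)
  ultimately have "2 * D * (n * n) \<le> D * (n * n) + D * (D * card C)"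
    using sq by linarith
  moreover have "D * (D * card C) < D * (n * n)" if "0 < D"
    using few that unfolding D_def by simp
  \<comment> \<open>Positivity allows \<open>D\<close> to be cancelled: \<open>T = 0\<close> would
    make all color classes empty, against \<open>few\<close>.\<close>
  moreover have "0 < D"
  proof (rule ccontr)
    assume "\<not> 0 < D"
    then have "T = 0" by (simp add: D_def)
    then have "n * n = 0" using total EP by simp
    then show False using few by simp
  qed
  ultimately show False by simp
qed

lemma repeated_partner:
  assumes "X \<subseteq> repeated V d a1 a2"
  obtains f where "f ` X \<subseteq> V" "\<And>b. b \<in> X \<Longrightarrow> d a1 (f b) = d a2 b"
proof -
  have "\<forall>b\<in>X. \<exists>b'. b' \<in> V \<and> d a1 b' = d a2 b" using assms unfolding repeated_def by blast
  then obtain f where "\<forall>b\<in>X. f b \<in> V \<and> d a1 (f b) = d a2 b" by metis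
  then show thesis using that by blast
qed

text \<open>Each element of \<open>X\<close> costs at most two lines of the rectangle, itself and
  its partner under \<open>f\<close>; \<open>Y\<close> holds the lines reserved for other
  purposes.\<close>

lemma card_union_image_le:
  assumes "finite X" "finite Y" "card Y + 2 * card X \<le> t"
  shows "card (Y \<union> (X \<union> f ` X)) \<le> t"
proof -
  have "card (Y \<union> (X \<union> f ` X)) \<le> card Y + (card X + card (f ` X))"
    by (meson add_left_mono card_Un_le order_trans)
  also have "\<dots> \<le> card Y + 2 * card X" using card_image_le[OF assms(1), of f] by simp
  finally show ?thesis using assms by simp
qed

text \<open>The redundant cells are \<open>m\<close> repeats in row \<open>a2\<close>. Their
  partners lie in the different row \<open>a1\<close>, so the whole configuration fits into two rows
  and \<open>2 * m\<close> columns.\<close>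

lemma repeated_rows_has_repeats:
  assumes fin: "finite U" "finite V"
    and a: "a1 \<in> U" "a2 \<in> U" "a1 \<noteq> a2" and m: "m \<le> card (repeated V d a1 a2)"
    and st: "2 \<le> s" "2 * m \<le> t" "s \<le> card U" "t \<le> card V"
  shows "has_repeats s t m U V d"
proof -
  obtain X where X: "X \<subseteq> repeated V d a1 a2" "card X = m" "finite X"
    using m by (meson obtain_subset_with_card_n)
  obtain f where f: "f ` X \<subseteq> V" "\<And>b. b \<in> X \<Longrightarrow> d a1 (f b) = d a2 b"
    using repeated_partner[OF X(1)] by blast
  define R where "R = {a2} \<times> X"
  define S where "S = R \<union> {a1} \<times> f ` X"
  have XV: "X \<subseteq> V" using X by (auto simp: repeated_def)
  have "fst ` S \<subseteq> {a1, a2}" unfolding S_def R_def by auto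
  then have "card (fst ` S) \<le> card {a1, a2}" by (intro card_mono) auto
  also have "\<dots> \<le> s" using st by (simp add: a)
  finally have 1: "card (fst ` S) \<le> s" .
  \<comment> \<open>The empty set plays the role of \<open>Y\<close> in
    \<open>card_union_image_le\<close>.\<close>
  have "snd ` S \<subseteq> {} \<union> (X \<union> f ` X)" unfolding S_def R_def by auto
  then have "card (snd ` S) \<le> card ({} \<union> (X \<union> f ` X))" using X by (intro card_mono) auto
  also have "\<dots> \<le> t" using X st by (intro card_union_image_le) auto
  finally have 2: "card (snd ` S) \<le> t" .
  have "case_prod d ` R \<subseteq> case_prod d ` (S - R)"
  proof
    fix \<gamma> assume "\<gamma> \<in> case_prod d ` R"
    then obtain b where b: "b \<in> X" "\<gamma> = d a2 b" unfolding R_def by auto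
    then have "(a1, f b) \<in> S - R" "case_prod d (a1, f b) = \<gamma>"
      using a f unfolding S_def R_def by auto
    then show "\<gamma> \<in> case_prod d ` (S - R)" by blast
  qed
  moreover have "S \<subseteq> U \<times> V"
    unfolding S_def R_def using a(1,2) f(1) XV by blast
  moreover have "R \<subseteq> S" unfolding S_def by blast
  ultimately have "has_repeats s t (card R) U V d"
    using has_repeatsI[OF fin _ 1 st(3) 2 st(4)] by blast
  then show ?thesis using X by (simp add: R_def card_cartesian_product)
qed

lemma choose_avoiding:
  assumes "finite Z" "card Z + m \<le> card Q"
  obtains X where "X \<subseteq> Q" "X \<inter> Z = {}" "card X = m" "finite X"
proof -
  have "m \<le> card Q - card Z" using assms by simp
  also have "\<dots> \<le> card (Q - Z)" using assms(1) by (rule diff_card_le_card_Diff)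
  finally obtain X where "X \<subseteq> Q - Z" "card X = m" "finite X"
    by (meson obtain_subset_with_card_n)
  then show thesis using that by blast
qed

text \<open>A row configuration and a column configuration share one rectangle. The rows are
  \<open>a1\<close>, \<open>a2\<close> and at most \<open>2 * l\<close> more, the columns
  \<open>b1\<close>, \<open>b2\<close> and at most \<open>2 * m\<close> more. The two spare repeats
  on each side allow \<open>X\<close> to avoid \<open>b1\<close>, \<open>b2\<close> and
  \<open>Y\<close> to avoid \<open>a1\<close>, \<open>a2\<close>, which keeps the two configurations
  from interfering.\<close>

lemma repeated_rows_cols_has_repeats:
  assumes fin: "finite U" "finite V"
    and a: "a1 \<in> U" "a2 \<in> U" "a1 \<noteq> a2" "m + 2 \<le> card (repeated V d a1 a2)"
    and b: "b1 \<in> V" "b2 \<in> V" "b1 \<noteq> b2" "l + 2 \<le> card (repeated U (\<lambda>j i. d i j) b1 b2)"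
    and st: "2 + 2 * l \<le> s" "2 + 2 * m \<le> t" "s \<le> card U" "t \<le> card V"
  shows "has_repeats s t (l + m) U V d"
proof -
  obtain X where X: "X \<subseteq> repeated V d a1 a2" "X \<inter> {b1, b2} = {}" "card X = m" "finite X"
    using choose_avoiding[of "{b1, b2}" m "repeated V d a1 a2"] a b(3) by auto
  obtain Y where Y: "Y \<subseteq> repeated U (\<lambda>j i. d i j) b1 b2" "Y \<inter> {a1, a2} = {}" "card Y = l" "finite Y"
    using choose_avoiding[of "{a1, a2}" l "repeated U (\<lambda>j i. d i j) b1 b2"] b a(3) by auto
  obtain f where f: "f ` X \<subseteq> V" "\<And>b. b \<in> X \<Longrightarrow> d a1 (f b) = d a2 b"
    using repeated_partner[OF X(1)] by blast
  obtain g where g: "g ` Y \<subseteq> U" "\<And>a. a \<in> Y \<Longrightarrow> d (g a) b1 = d a b2"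
    using repeated_partner[OF Y(1)] by blast
  define R where "R = {a2} \<times> X \<union> Y \<times> {b2}"
  define S where "S = R \<union> {a1} \<times> f ` X \<union> g ` Y \<times> {b1}"
  have XV: "X \<subseteq> V" and YU: "Y \<subseteq> U" using X Y by (auto simp: repeated_def)
  have "fst ` S \<subseteq> {a1, a2} \<union> (Y \<union> g ` Y)" unfolding S_def R_def by auto
  then have "card (fst ` S) \<le> card ({a1, a2} \<union> (Y \<union> g ` Y))" using Y by (intro card_mono) auto
  also have "\<dots> \<le> s" using Y st a(3) by (intro card_union_image_le) auto
  finally have 1: "card (fst ` S) \<le> s" .
  have "snd ` S \<subseteq> {b1, b2} \<union> (X \<union> f ` X)" unfolding S_def R_def by auto
  then have "card (snd ` S) \<le> card ({b1, b2} \<union> (X \<union> f ` X))" using X by (intro card_mono) auto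
  also have "\<dots> \<le> t" using X st b(3) by (intro card_union_image_le) auto
  finally have 2: "card (snd ` S) \<le> t" .
  \<comment> \<open>Partners lie in row \<open>a1\<close> or column \<open>b1\<close>. They are
    outside \<open>R\<close> because \<open>a1\<close> differs from \<open>a2\<close> and is not in
    \<open>Y\<close>, and \<open>b1\<close> differs from \<open>b2\<close> and is not in
    \<open>X\<close>.\<close>
  have "case_prod d ` R \<subseteq> case_prod d ` (S - R)"
  proof
    fix \<gamma> assume "\<gamma> \<in> case_prod d ` R"
    then consider j where "j \<in> X" "\<gamma> = d a2 j" | i where "i \<in> Y" "\<gamma> = d i b2"
      unfolding R_def by auto
    then show "\<gamma> \<in> case_prod d ` (S - R)"
    proof cases
      case 1
      then have "(a1, f j) \<in> S - R" "case_prod d (a1, f j) = \<gamma>"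
        using a f Y(2) unfolding S_def R_def by auto
      then show ?thesis by blast
    next
      case 2
      then have "(g i, b1) \<in> S - R" "case_prod d (g i, b1) = \<gamma>"
        using b g X(2) unfolding S_def R_def by auto
      then show ?thesis by blast
    qed
  qed
  moreover have "S \<subseteq> U \<times> V"
    unfolding S_def R_def using a(1,2) b(1,2) f(1) g(1) XV YU by blast
  moreover have "R \<subseteq> S" unfolding S_def by blast
  ultimately have "has_repeats s t (card R) U V d"
    using has_repeatsI[OF fin _ 1 st(3) 2 st(4)] by blast
  moreover have "card R = l + m"
    unfolding R_def using X Y by (subst card_Un_disjoint) (auto simp: card_cartesian_product)
  ultimately show ?thesis by simp
qed

section \<open>From graph colorings to matrices\<close>

lemma card_edges_le_of_isomorphic:
  assumes "isomorphic F H" "simple_graph H" "finite (edges F)"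
  shows "card (edges H) \<le> card (edges F)"
proof -
  obtain f where bij: "bij_betw f (verts F) (verts H)"
    and f: "\<And>u v. u \<in> verts F \<Longrightarrow> v \<in> verts F \<Longrightarrow> {u, v} \<in> edges F \<longleftrightarrow> {f u, f v} \<in> edges H"
    using assms(1) unfolding isomorphic_def by blast
  have "edges H \<subseteq> image f ` edges F"
  proof
    fix e assume e: "e \<in> edges H"
    then have "e \<subseteq> verts H" "card e = 2" using assms(2) by (auto simp: simple_graph_def)
    then obtain x y where xy: "e = {x, y}" "x \<in> verts H" "y \<in> verts H"
      by (auto simp: card_2_iff)
    then obtain u v where "u \<in> verts F" "v \<in> verts F" "f u = x" "f v = y"
      using bij by (metis bij_betw_imp_surj_on imageE)
    then have "{u, v} \<in> edges F" "e = f ` {u, v}" using f e xy by auto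
    then show "e \<in> image f ` edges F" by blast
  qed
  then show ?thesis using assms(3) by (rule surj_card_le[rotated])
qed

lemma finite_edges_complete_bipartite: "finite (edges (complete_bipartite m n))"
proof -
  have "edges (complete_bipartite m n) = (\<lambda>(i, j). {Inl i, Inr j}) ` ({..<m} \<times> {..<n})"
    by (auto simp: complete_bipartite_def)
  then show ?thesis by simp
qed

text \<open>An injective coloring gives every copy of \<open>H\<close> as many colors as edges. This
  yields the quadratic upper bound and shows that the minimum in \<open>gen_ramsey\<close> is
  attained.\<close>

lemma rainbow_Hq_coloring:
  assumes "finite (edges G)" "simple_graph H" "q \<le> card (edges H)"
  obtains c where "c ` edges G \<subseteq> {..<card (edges G)}" "Hq_coloring G H q c"
proof -
  obtain c where c: "bij_betw c (edges G) {0..<card (edges G)}"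
    using ex_bij_betw_finite_nat[OF assms(1)] by blast
  have "q \<le> card (c ` edges F)" if "subgraph F G" "isomorphic F H" for F
  proof -
    have sub: "edges F \<subseteq> edges G" using that by (simp add: subgraph_def)
    then have "card (c ` edges F) = card (edges F)"
      using c by (meson bij_betw_imp_inj_on card_image inj_on_subset)
    then show ?thesis
      using card_edges_le_of_isomorphic[OF that(2) assms(2)] assms sub finite_subset by fastforce
  qed
  then have "Hq_coloring G H q c" by (simp add: Hq_coloring_def)
  moreover have "c ` edges G \<subseteq> {..<card (edges G)}"
    using c by (auto simp: bij_betw_def)
  ultimately show thesis using that by blast
qed

text \<open>Arbitrary vertex classes make it possible to regard a rectangle
  \<open>A \<times> B\<close> of the matrix as a subgraph.\<close>

definition biclique :: "'a set \<Rightarrow> 'b set \<Rightarrow> ('a + 'b) graph" where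
  "biclique A B = \<lparr>verts = Inl ` A \<union> Inr ` B, edges = {{Inl i, Inr j} | i j. i \<in> A \<and> j \<in> B}\<rparr>"

lemma complete_bipartite_eq_biclique: "complete_bipartite m n = biclique {..<m} {..<n}"
  by (simp add: complete_bipartite_def biclique_def)

lemma simple_graph_biclique: "simple_graph (biclique A B)"
  by (auto simp: simple_graph_def biclique_def)

lemma biclique_edge_iff:
  assumes "u \<in> verts (biclique A B)" "v \<in> verts (biclique A B)"
  shows "{u, v} \<in> edges (biclique A B) \<longleftrightarrow> isl u \<noteq> isl v"
  using assms by (cases u; cases v) (auto simp: biclique_def doubleton_eq_iff)

text \<open>Adjacency means lying on opposite sides, so a bijection only has to respect whether two
  vertices share a side. It may preserve the two sides or exchange them.\<close>

lemma isomorphic_bicliqueI: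
  assumes h: "bij_betw h (verts (biclique A B)) (verts (biclique A' B'))"
    and isl: "\<And>u v. isl (h u) = isl (h v) \<longleftrightarrow> isl u = isl v"
  shows "isomorphic (biclique A B) (biclique A' B')"
  unfolding isomorphic_def
proof (intro exI conjI ballI)
  fix u v assume uv: "u \<in> verts (biclique A B)" "v \<in> verts (biclique A B)"
  then have "h u \<in> verts (biclique A' B')" "h v \<in> verts (biclique A' B')"
    using h by (auto dest: bij_betwE)
  then show "{u, v} \<in> edges (biclique A B) \<longleftrightarrow> {h u, h v} \<in> edges (biclique A' B')"
    using uv isl by (simp add: biclique_edge_iff)
qed (rule h)

lemma isomorphic_biclique:
  assumes f: "bij_betw f A A'" and g: "bij_betw g B B'"
  shows "isomorphic (biclique A B) (biclique A' B')"
proof (rule isomorphic_bicliqueI)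
  have inj: "inj_on f A" "inj_on g B" and im: "f ` A = A'" "g ` B = B'"
    using f g by (auto simp: bij_betw_def)
  show "bij_betw (map_sum f g) (verts (biclique A B)) (verts (biclique A' B'))"
  proof (rule bij_betw_imageI)
    show "inj_on (map_sum f g) (verts (biclique A B))"
      using inj by (intro inj_onI) (auto simp: biclique_def dest: inj_onD)
    have "map_sum f g ` verts (biclique A B) = Inl ` f ` A \<union> Inr ` g ` B"
      by (simp add: biclique_def image_Un image_image)
    then show "map_sum f g ` verts (biclique A B) = verts (biclique A' B')"
      unfolding im by (simp add: biclique_def Un_commute)
  qed
  show "isl (map_sum f g u) = isl (map_sum f g v) \<longleftrightarrow> isl u = isl v" for u v
    by (cases u; cases v) auto
qed

lemma isomorphic_biclique_swap:
  assumes f: "bij_betw f A B'" and g: "bij_betw g B A'"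
  shows "isomorphic (biclique A B) (biclique A' B')"
proof (rule isomorphic_bicliqueI)
  let ?h = "case_sum (\<lambda>i. Inr (f i)) (\<lambda>j. Inl (g j))"
  have inj: "inj_on f A" "inj_on g B" and im: "f ` A = B'" "g ` B = A'"
    using f g by (auto simp: bij_betw_def)
  show "bij_betw ?h (verts (biclique A B)) (verts (biclique A' B'))"
  proof (rule bij_betw_imageI)
    show "inj_on ?h (verts (biclique A B))"
      using inj by (intro inj_onI) (auto simp: biclique_def dest: inj_onD)
    have "?h ` verts (biclique A B) = Inr ` f ` A \<union> Inl ` g ` B"
      by (simp add: biclique_def image_Un image_image)
    then show "?h ` verts (biclique A B) = verts (biclique A' B')"
      unfolding im by (simp add: biclique_def Un_commute)
  qed
  show "isl (?h u) = isl (?h v) \<longleftrightarrow> isl u = isl v" for u v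
    by (cases u; cases v) auto
qed

text \<open>A rectangle spans a copy of \<open>complete_bipartite s t\<close> in either orientation,
  as the two sides of a biclique may be exchanged.\<close>

lemma Hq_coloring_rectangle:
  assumes c: "Hq_coloring (complete_bipartite n n) (complete_bipartite s t) q c"
    and AB: "A \<subseteq> {..<n}" "B \<subseteq> {..<n}"
    and card: "card A = s \<and> card B = t \<or> card A = t \<and> card B = s"
  shows "q \<le> card (case_prod (\<lambda>i j. c {Inl i, Inr j}) ` (A \<times> B))"
proof -
  have fin: "finite A" "finite B" using AB finite_subset by blast+
  have "verts (biclique A B) \<subseteq> verts (complete_bipartite n n)"
    using AB unfolding complete_bipartite_eq_biclique biclique_def by auto
  moreover have "edges (biclique A B) \<subseteq> edges (complete_bipartite n n)"
    unfolding complete_bipartite_eq_biclique biclique_def graph.simps using AB by blast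
  ultimately have "subgraph (biclique A B) (complete_bipartite n n)"
    by (simp add: subgraph_def simple_graph_biclique)
  moreover have "isomorphic (biclique A B) (complete_bipartite s t)"
  proof -
    obtain f g where f: "bij_betw f A {..<card A}" and g: "bij_betw g B {..<card B}"
      using ex_bij_betw_finite_nat fin by (metis atLeast0LessThan)
    from card show ?thesis
    proof
      assume "card A = s \<and> card B = t"
      then show ?thesis
        using isomorphic_biclique[OF f g] by (simp add: complete_bipartite_eq_biclique)
    next
      assume "card A = t \<and> card B = s"
      then show ?thesis
        using isomorphic_biclique_swap[OF f g] by (simp add: complete_bipartite_eq_biclique)
    qed
  qed
  ultimately have "q \<le> card (c ` edges (biclique A B))" using c by (simp add: Hq_coloring_def)
  also have "c ` edges (biclique A B) = case_prod (\<lambda>i j. c {Inl i, Inr j}) ` (A \<times> B)"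
    unfolding biclique_def by auto
  finally show ?thesis .
qed

text \<open>The upper bound comes from the rainbow coloring. For the lower bound, an optimal
  coloring with too few colors would contain a copy that loses \<open>x\<close> colors and so has at
  most \<open>s * t - x = q - 1\<close> of them. The constant \<open>D\<close> does not depend on
  \<open>n\<close>.\<close>

lemma gen_ramsey_bigtheta:
  assumes q: "q + x = s * t + 1" "1 \<le> x"
    and rep: "\<And>n k (d :: nat \<Rightarrow> nat \<Rightarrow> nat). t \<le> n \<Longrightarrow> s \<le> n \<Longrightarrow>
      (\<And>i j. i < n \<Longrightarrow> j < n \<Longrightarrow> d i j < k) \<Longrightarrow> D * k < n * n \<Longrightarrow>
      has_repeats s t x {..<n} {..<n} d \<or> has_repeats t s x {..<n} {..<n} d"
  shows "(\<lambda>n. real (gen_ramsey (complete_bipartite n n) (complete_bipartite s t) q))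
    \<in> \<Theta>(\<lambda>n. real n ^ 2)"
proof -
  let ?r = "\<lambda>n. gen_ramsey (complete_bipartite n n) (complete_bipartite s t) q"
  have ex: "\<exists>c. c ` edges (complete_bipartite n n) \<subseteq> {..<n * n} \<and>
      Hq_coloring (complete_bipartite n n) (complete_bipartite s t) q c" for n
  proof -
    have "q \<le> card (edges (complete_bipartite s t))"
      using q by (simp add: card_edges_complete_bipartite)
    from rainbow_Hq_coloring[OF finite_edges_complete_bipartite simple_graph_complete_bipartite this]
    show ?thesis by (metis card_edges_complete_bipartite)
  qed
  have upper: "?r n \<le> n * n" for n
    unfolding gen_ramsey_def by (rule Least_le) (rule ex)
  have lower: "n * n \<le> D * ?r n" if n: "s + t \<le> n" for n
  proof (rule ccontr)
    assume less: "\<not> n * n \<le> D * ?r n"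
    \<comment> \<open>A coloring that attains the minimum.\<close>
    obtain c where c: "c ` edges (complete_bipartite n n) \<subseteq> {..<?r n}"
      and H: "Hq_coloring (complete_bipartite n n) (complete_bipartite s t) q c"
    proof -
      let ?Q = "\<lambda>k. \<exists>c. c ` edges (complete_bipartite n n) \<subseteq> {..<k} \<and>
        Hq_coloring (complete_bipartite n n) (complete_bipartite s t) q c"
      have "?Q (LEAST k. ?Q k)" using LeastI[where P = ?Q, OF ex] .
      then have "?Q (?r n)" by (simp only: gen_ramsey_def)
      then show thesis using that by blast
    qed
    define d where "d i j = c {Inl i, Inr j}" for i j
    have col: "d i j < ?r n" if "i < n" "j < n" for i j
    proof -
      have "{Inl i, Inr j} \<in> edges (complete_bipartite n n)"
        using that by (auto simp: complete_bipartite_def)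
      then show ?thesis using c unfolding d_def by blast
    qed
    have "has_repeats s t x {..<n} {..<n} d \<or> has_repeats t s x {..<n} {..<n} d"
      by (rule rep[OF _ _ col]) (use n less in auto)
    then obtain A B where AB: "A \<subseteq> {..<n}" "B \<subseteq> {..<n}"
      "card A = s \<and> card B = t \<or> card A = t \<and> card B = s"
      and few: "card (case_prod d ` (A \<times> B)) + x \<le> s * t"
      unfolding has_repeats_def by (metis mult.commute)
    have "q \<le> card (case_prod d ` (A \<times> B))"
      using Hq_coloring_rectangle[OF H AB] unfolding d_def .
    then show False using few q by linarith
  qed
  show ?thesis
  proof
    show "(\<lambda>n. real (?r n)) \<in> O(\<lambda>n. real n ^ 2)"
      by (rule bigoI[where c = 1])
        (use upper in \<open>simp add: power2_eq_square flip: of_nat_mult\<close>)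
    have "real n ^ 2 \<le> real D * real (?r n)" if "s + t \<le> n" for n
      using lower[OF that] by (simp add: power2_eq_square flip: of_nat_mult)
    then have "(\<lambda>n. real n ^ 2) \<in> O(\<lambda>n. real (?r n))"
      by (intro bigoI[where c = "real D"] eventually_sequentiallyI[of "s + t"]) simp
    then show "(\<lambda>n. real (?r n)) \<in> \<Omega>(\<lambda>n. real n ^ 2)" by (simp add: bigomega_iff_bigo)
  qed
qed

section \<open>Lost colors forced by few colors\<close>

text \<open>By pigeonhole some color class has \<open>s\<close> cells; these meet at most
  \<open>s\<close> rows and at most \<open>s \<le> t\<close> columns, wherever they lie.\<close>

lemma few_colors_monochromatic_repeats:
  fixes d :: "nat \<Rightarrow> nat \<Rightarrow> nat"
  assumes st: "1 \<le> s" "s \<le> t" "t \<le> n"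
    and col: "\<And>i j. i < n \<Longrightarrow> j < n \<Longrightarrow> d i j < k" and few: "s * k < n * n"
  shows "has_repeats s t (s - 1) {..<n} {..<n} d"
proof -
  define E where "E \<gamma> = {e \<in> {..<n} \<times> {..<n}. case_prod d e = \<gamma>}" for \<gamma>
  have "\<exists>\<gamma>. s \<le> card (E \<gamma>)"
  proof (rule ccontr)
    assume "\<not> ?thesis"
    then have less: "card (E \<gamma>) \<le> s" for \<gamma> by (meson nle_le)
    have "{..<n} \<times> {..<n} = (\<Union>\<gamma>\<in>{..<k}. E \<gamma>)" using col unfolding E_def by auto
    then have "n * n = card (\<Union>\<gamma>\<in>{..<k}. E \<gamma>)"
      by (metis card_cartesian_product card_lessThan)
    also have "\<dots> \<le> (\<Sum>\<gamma>\<in>{..<k}. card (E \<gamma>))" by (rule card_UN_le) simp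
    also have "\<dots> \<le> (\<Sum>\<gamma>\<in>{..<k}. s)" using less by (intro sum_mono)
    finally show False using few by (simp add: mult.commute)
  qed
  then obtain \<gamma> where "s \<le> card (E \<gamma>)" by blast
  then obtain S where S: "S \<subseteq> E \<gamma>" "card S = s" "finite S"
    by (meson obtain_subset_with_card_n)
  have "card (fst ` S) \<le> s" "card (snd ` S) \<le> s" using S card_image_le by metis+
  moreover have "S \<noteq> {}" using S st by auto
  ultimately have "has_repeats s t (card S - 1) {..<n} {..<n} d"
    using S st by (intro monochromatic_has_repeats[where \<gamma> = \<gamma>]) (auto simp: E_def)
  then show ?thesis using S by simp
qed

text \<open>The constant in \<open>few\<close> is that of \<open>exists_repeated_rows\<close> with
  \<open>T = t\<close>, which holds when no row contains a monochromatic star of \<open>t\<close>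
  edges, and \<open>M = t div 2\<close>.\<close>

lemma few_colors_row_repeats:
  fixes d :: "nat \<Rightarrow> nat \<Rightarrow> nat"
  assumes st: "2 \<le> s" "s \<le> t" "t \<le> n"
    and col: "\<And>i j. i < n \<Longrightarrow> j < n \<Longrightarrow> d i j < k" and few: "t * (t div 2 + 1) * k < n * n"
  shows "has_repeats s t (t div 2) {..<n} {..<n} d"
proof (cases "\<exists>i<n. \<exists>\<gamma>. t \<le> card {j \<in> {..<n}. d i j = \<gamma>}")
  case True
  then obtain i \<gamma> where "i < n" "t \<le> card {j \<in> {..<n}. d i j = \<gamma>}" by blast
  then have "has_repeats s t (t - 1) {..<n} {..<n} d"
    using st by (intro star_has_repeats[where i = i and \<gamma> = \<gamma>]) auto
  then show ?thesis by (rule has_repeats_mono) (use st in linarith)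
next
  case False
  then have "card {j \<in> {..<n}. d i j = \<gamma>} \<le> t" if "i < n" for i \<gamma>
    using that by (meson nle_le)
  then have "\<exists>a1\<in>{..<n}. \<exists>a2\<in>{..<n}. a1 \<noteq> a2 \<and> t div 2 < card (repeated {..<n} d a1 a2)"
    using col few by (intro exists_repeated_rows[where n = n and C = "{..<k}" and T = t]) auto
  then obtain a1 a2 where "a1 \<in> {..<n}" "a2 \<in> {..<n}" "a1 \<noteq> a2"
    "t div 2 < card (repeated {..<n} d a1 a2)" by blast
  then show ?thesis
    using st by (intro repeated_rows_has_repeats[of _ _ a1 a2]) auto
qed

text \<open>A large star centered on the right fits only the transposed rectangle, hence the
  disjunction. Without large stars, \<open>M = t\<close> leaves enough repeats on both sides to
  discard two of them.\<close>

lemma few_colors_row_col_repeats: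
  fixes d :: "nat \<Rightarrow> nat \<Rightarrow> nat"
  assumes st: "2 \<le> s" "s \<le> t" "t \<le> n"
    and col: "\<And>i j. i < n \<Longrightarrow> j < n \<Longrightarrow> d i j < k" and few: "t * (t + 1) * k < n * n"
  shows "has_repeats s t ((s - 2) div 2 + (t - 2) div 2) {..<n} {..<n} d \<or>
    has_repeats t s ((s - 2) div 2 + (t - 2) div 2) {..<n} {..<n} d"
    (is "has_repeats s t ?x _ _ _ \<or> _")
proof -
  \<comment> \<open>Each half is at most \<open>(t - 2) div 2\<close>, so a star with
    \<open>t\<close> edges loses enough colors by itself.\<close>
  have x: "?x \<le> t - 1" using st by linarith
  consider (row) i \<gamma> where "i < n" "t \<le> card {j \<in> {..<n}. d i j = \<gamma>}"
    | (col) j \<gamma> where "j < n" "t \<le> card {i \<in> {..<n}. d i j = \<gamma>}"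
    | (none) "\<And>i \<gamma>. i < n \<Longrightarrow> card {j \<in> {..<n}. d i j = \<gamma>} \<le> t"
      "\<And>j \<gamma>. j < n \<Longrightarrow> card {i \<in> {..<n}. d i j = \<gamma>} \<le> t"
    by (meson nle_le)
  then show ?thesis
  proof cases
    case row
    then have "has_repeats s t (t - 1) {..<n} {..<n} d"
      using st by (intro star_has_repeats[where i = i and \<gamma> = \<gamma>]) auto
    then show ?thesis using x has_repeats_mono by blast
  next
    case col
    then have "has_repeats s t (t - 1) {..<n} {..<n} (\<lambda>j i. d i j)"
      using st by (intro star_has_repeats[where i = j and \<gamma> = \<gamma>]) auto
    then show ?thesis using x has_repeats_mono has_repeats_swap by blast
  next
    case none
    have "\<exists>a1\<in>{..<n}. \<exists>a2\<in>{..<n}. a1 \<noteq> a2 \<and> t < card (repeated {..<n} d a1 a2)"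
      using none col few by (intro exists_repeated_rows[where n = n and C = "{..<k}" and T = t]) auto
    then obtain a1 a2 where a: "a1 \<in> {..<n}" "a2 \<in> {..<n}" "a1 \<noteq> a2"
      "t < card (repeated {..<n} d a1 a2)" by blast
    have "\<exists>b1\<in>{..<n}. \<exists>b2\<in>{..<n}. b1 \<noteq> b2 \<and> t < card (repeated {..<n} (\<lambda>j i. d i j) b1 b2)"
      using none col few by (intro exists_repeated_rows[where n = n and C = "{..<k}" and T = t]) auto
    then obtain b1 b2 where b: "b1 \<in> {..<n}" "b2 \<in> {..<n}" "b1 \<noteq> b2"
      "t < card (repeated {..<n} (\<lambda>j i. d i j) b1 b2)" by blast
    have "has_repeats s t ?x {..<n} {..<n} d"
      using st a b by (intro repeated_rows_cols_has_repeats[of _ _ a1 a2 _ _ b1 b2]) auto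
    then show ?thesis ..
  qed
qed

section \<open>The four quadratic thresholds\<close>

theorem theorem1p3:
  fixes s t :: nat
  assumes "2 \<le> s" and "s \<le> t"
  shows
    "(\<lambda>n. real (gen_ramsey (complete_bipartite n n) (complete_bipartite s t)
        (s * t - s + 2))) \<in> \<Theta>(\<lambda>n. real n ^ 2) \<and>
     (2 \<le> s \<and> s \<le> 3 \<longrightarrow>
       (\<lambda>n. real (gen_ramsey (complete_bipartite n n) (complete_bipartite s t)
        (s * t - t div 2 + 1))) \<in> \<Theta>(\<lambda>n. real n ^ 2)) \<and>
     (4 \<le> s \<and> (even s \<or> even t) \<longrightarrow>
       (\<lambda>n. real (gen_ramsey (complete_bipartite n n) (complete_bipartite s t)
        (s * t - (s + t) div 2 + 3))) \<in> \<Theta>(\<lambda>n. real n ^ 2)) \<and>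
     (5 \<le> s \<and> odd s \<and> odd t \<longrightarrow>
       (\<lambda>n. real (gen_ramsey (complete_bipartite n n) (complete_bipartite s t)
        (s * t - (s + t) div 2 + 4))) \<in> \<Theta>(\<lambda>n. real n ^ 2))"
proof -
  note st = assms
  \<comment> \<open>These bounds ensure that the subtractions in the thresholds do not
    truncate.\<close>
  have t: "2 * t \<le> s * t" using st by simp
  have s: "s \<le> s * t" using st by simp
  let ?r = "\<lambda>q n. real (gen_ramsey (complete_bipartite n n) (complete_bipartite s t) q)"
  have 1: "?r (s * t - s + 2) \<in> \<Theta>(\<lambda>n. real n ^ 2)"
  proof (rule gen_ramsey_bigtheta)
    show "s * t - s + 2 + (s - 1) = s * t + 1" "1 \<le> s - 1" using st s by linarith+
  qed (rule disjI1, rule few_colors_monochromatic_repeats, use st in auto)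
  have 2: "?r (s * t - t div 2 + 1) \<in> \<Theta>(\<lambda>n. real n ^ 2)"
  proof (rule gen_ramsey_bigtheta)
    show "s * t - t div 2 + 1 + t div 2 = s * t + 1" "1 \<le> t div 2" using st t by linarith+
  qed (rule disjI1, rule few_colors_row_repeats, use st in auto)
  \<comment> \<open>Parts (iii) and (iv) both lose \<open>s div 2 + t div 2 - 2\<close> colors; they
    differ only in how this compares with \<open>(s + t) div 2\<close>.\<close>
  have row_col: "?r q \<in> \<Theta>(\<lambda>n. real n ^ 2)"
    if "4 \<le> s" and q: "q + ((s - 2) div 2 + (t - 2) div 2) = s * t + 1" for q
  proof (rule gen_ramsey_bigtheta[OF q, where D = "t * (t + 1)"])
    show "1 \<le> (s - 2) div 2 + (t - 2) div 2" using that by linarith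
    fix n k :: nat and d :: "nat \<Rightarrow> nat \<Rightarrow> nat"
    assume n: "t \<le> n" "\<And>i j. i < n \<Longrightarrow> j < n \<Longrightarrow> d i j < k" "t * (t + 1) * k < n * n"
    show "has_repeats s t ((s - 2) div 2 + (t - 2) div 2) {..<n} {..<n} d \<or>
        has_repeats t s ((s - 2) div 2 + (t - 2) div 2) {..<n} {..<n} d"
      by (rule few_colors_row_col_repeats[OF st n])
  qed
  have half: "(s - 2) div 2 + 1 = s div 2" "(t - 2) div 2 + 1 = t div 2" using st by linarith+
  have le: "(s + t) div 2 \<le> s * t" using st t by linarith
  have shift: "m - h + c + x = m + 1" if "x + c = h + 1" "h \<le> m" for m h c x :: nat
    using that by linarith
  have 3: "?r (s * t - (s + t) div 2 + 3) \<in> \<Theta>(\<lambda>n. real n ^ 2)"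
    if "4 \<le> s" "even s \<or> even t"
  proof -
    have "(s + t) div 2 = s div 2 + t div 2"
      using that(2) by (metis div_plus_div_distrib_dvd_left div_plus_div_distrib_dvd_right)
    then have "(s - 2) div 2 + (t - 2) div 2 + 3 = (s + t) div 2 + 1" using half by simp
    from row_col[OF that(1) shift[OF this le]] show ?thesis .
  qed
  have 4: "?r (s * t - (s + t) div 2 + 4) \<in> \<Theta>(\<lambda>n. real n ^ 2)"
    if "5 \<le> s" "odd s" "odd t"
  proof -
    \<comment> \<open>For two odd numbers the separate halves fall one short of the joint half, so
      the additive constant is 4 instead of 3.\<close>
    have "(s + t) div 2 = s div 2 + t div 2 + 1"
      using odd_two_times_div_two_succ[OF that(2)] odd_two_times_div_two_succ[OF that(3)] by linarith
    then have q: "(s - 2) div 2 + (t - 2) div 2 + 4 = (s + t) div 2 + 1" using half by simp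
    have "4 \<le> s" using that by simp
    from row_col[OF this shift[OF q le]] show ?thesis .
  qed
  show ?thesis using 1 2 3 4 by blast
qed

end
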